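(* Let $C$, $B_1,\dots,B_K$ and $a$ be the elements of the semi-definite program associated with Polya's theorem for given $A(\alpha)$, $d_p$, $d_1$, $d_2$, as defined in the context, and let $L$ and $M$ be the cardinalities of $W_{d_p+d_1}$ and $W_{d_{pa}+d_2}$. Let $(X_k,y_k,Z_k)_{k\in\mathbb{N}}$ be the iterates generated by the primal-dual predictor-corrector iteration described in the context for this semi-definite program. If the iteration is initialized by $$X_0\in S_{L,M,n},\qquad y_0\in\mathbb{R}^K,\qquad Z_0\in S_{L,M,n},$$ then for all $k\in\mathbb{N}$, $$X_k\in S_{L,M,n},\qquad Z_k\in S_{L,M,n}.$$
   Context: **Block-diagonal subspace.** $S_{L,M,n}:=\{Y\in\mathbb{R}^{(L+M)n\times(L+M)n}: Y=\mathrm{diag}(Y_1,\dots,Y_L,Y_{L+1},\dots,Y_{L+M}),\ Y_i\in\mathbb{R}^{n\times n}\}$. **Data.** $\mathbb{S}^n$ denotes the real symmetric $n\times n$ matrices. $W_d:=\{\gamma\in\mathbb{N}^l:\sum_{i=1}^l\gamma_i=d\}$, ordered lexicographically, and $\langle\gamma\rangle$ denotes the position (index) of $\gamma$ in $W_d$. $A(\alpha)=\sum_{\gamma\in W_{d_a}}A_{\langle\gamma\rangle}\alpha^\gamma$ is a homogeneous polynomial of degree $d_a$ in $\alpha\in\mathbb{R}^l$ with $A_{\langle\gamma\rangle}\in\mathbb{R}^{n\times n}$. $P(\alpha)=\sum_{h\in W_{d_p}}P_{\langle h\rangle}\alpha^h$ has unknown coefficients $P_{\langle h\rangle}\in\mathbb{S}^n$.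 $d_{pa}:=d_p+d_a$, and $d_1,d_2\in\mathbb{N}$ are the Polya exponents. The scalars $\beta_{\langle h\rangle,\langle\gamma\rangle}$ and the matrices $H_{\langle h\rangle,\langle\gamma\rangle}\in\mathbb{R}^{n\times n}$ are defined by $$\Big(\sum_{i=1}^l\alpha_i\Big)^{d_1}P(\alpha)=\sum_{\gamma\in W_{d_p+d_1}}\Big(\sum_{h\in W_{d_p}}\beta_{\langle h\rangle,\langle\gamma\rangle}P_{\langle h\rangle}\Big)\alpha^\gamma,\qquad \Big(\sum_{i=1}^l\alpha_i\Big)^{d_2}\alpha^hA(\alpha)=\sum_{\gamma\in W_{d_{pa}+d_2}}H_{\langle h\rangle,\langle\gamma\rangle}\alpha^\gamma ,$$ so that $\big(\sum_i\alpha_i\big)^{d_2}(A^TP+PA)=\sum_\gamma\sum_h\big(H_{\langle h\rangle,\langle\gamma\rangle}^TP_{\langle h\rangle}+P_{\langle h\rangle}H_{\langle h\rangle,\langle\gamma\rangle}\big)\alpha^\gamma$. **SDP elements.** $\tilde N:=n(n+1)/2$, and $K:=\tilde N\binom{d_p+l-1}{l-1}$. $E_1,\dots,E_{\tilde N}$ is the canonical basis of $\mathbb{S}^n$ (first the $n$ diagonal matrix units, then the matrices with ones in two symmetric off-diagonal positions and zeros elsewhere). For $x\in\mathbb{R}^K$ and $h\in W_{d_p}$, $V_{\langle h\rangle}(x):=\sum_{j=1}^{\tilde N}E_j\,x_{j+\tilde N(\langle h\rangle-1)}$. $e_i$ is the $i$-th canonical basis vector of $\mathbb{R}^K$, and $\delta>0$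 is a small parameter. - $C:=\mathrm{diag}(C_1,\dots,C_{L+M})$, with $C_i:=\delta I_n\sum_{h\in W_{d_p}}\beta_{\langle h\rangle,i}\frac{d_p!}{h_1!\cdots h_l!}$ for $1\le i\le L$, and $C_i:=0_n$ for $L+1\le i\le L+M$. - $B_i:=\mathrm{diag}(B_{i,1},\dots,B_{i,L+M})$ for $i=1,\dots,K$, with $B_{i,j}:=\sum_{h\in W_{d_p}}\beta_{\langle h\rangle,j}V_{\langle h\rangle}(e_i)$ for $1\le j\le L$, and $B_{i,j}:=-\sum_{h\in W_{d_p}}\big(H_{\langle h\rangle,j-L}^TV_{\langle h\rangle}(e_i)+V_{\langle h\rangle}(e_i)H_{\langle h\rangle,j-L}\big)$ for $L+1\le j\le L+M$. - $a:=(1,\dots,1)^T\in\mathbb{R}^K$. The primal SDP is $\max\{\mathrm{tr}(CX): B(X)=a,\ X\ge0\}$, where $B(X):=(\mathrm{tr}(B_1X),\dots,\mathrm{tr}(B_KX))^T$. The dual SDP is $\min\{a^Ty:\sum_{i=1}^KB_iy_i-C=Z,\ Z\ge0,\ y\in\mathbb{R}^K\}$. **Iteration.** Given $(X,y,Z)=(X_k,y_k,Z_k)$, put $G:=-\sum_{i=1}^KB_iy_i+Z+C$ and $\Omega:=[B(Z^{-1}B_1X)\ \cdots\ B(Z^{-1}B_KX)]\in\mathbb{R}^{K\times K}$. It is assumed throughout that the iterates are well defined, i.e. that every $Z_k$ and every $\Omega$ that occurs is invertible. Predictor step: $$\Delta\hat y=\Omega^{-1}\big(-a+B(Z^{-1}GX)\big),\quad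 \Delta\hat X=-X+Z^{-1}\Big(G-\sum_{i=1}^KB_i\Delta\hat y_i\Big)X,\quad \Delta\hat Z=\sum_{i=1}^KB_iy_i-Z-C+\sum_{i=1}^KB_i\Delta\hat y_i.$$ Corrector step, with barrier parameter $\mu\in\mathbb{R}$ (a number computed from the current iterate): $$\Delta\bar y=\Omega^{-1}\big(B(\mu Z^{-1})-B(Z^{-1}\Delta\hat Z\,\Delta\hat X)\big),\quad \Delta\bar Z=\sum_{i=1}^KB_i\Delta\bar y_i,\quad \Delta\bar X=\mu Z^{-1}-Z^{-1}\Delta\hat Z\,\Delta\hat X-Z^{-1}\Delta\bar Z\,X.$$ Search directions: $\Delta X=\mathrm{Sym}(\Delta\hat X+\Delta\bar X)$ with $\mathrm{Sym}(W):=(W+W^T)/2$, $\Delta y=\Delta\hat y+\Delta\bar y$, $\Delta Z=\Delta\hat Z+\Delta\bar Z$. Update, with real step sizes $t_p,t_d$ (from a line search, possibly depending on $k$): $X_{k+1}=X_k+t_p\Delta X$, $y_{k+1}=y_k+t_d\Delta y$, $Z_{k+1}=Z_k+t_d\Delta Z$. *)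

theory Defs
  imports "Jordan_Normal_Form.Gauss_Jordan_Elimination"
begin

subsection \<open>Matrices\<close>

text \<open>The type \<^typ>\<open>'a mat\<close> carries no zero element, hence no sum over finite sets; sums of
  \<open>n \<times> n\<close> matrices are taken entrywise.\<close>

definition mat_sum :: "nat \<Rightarrow> ('b \<Rightarrow> real mat) \<Rightarrow> 'b set \<Rightarrow> real mat" where
  "mat_sum n F I = mat n n (\<lambda>(r, c). \<Sum>i\<in>I. F i $$ (r, c))"

definition mat_trace :: "real mat \<Rightarrow> real" where
  "mat_trace A = (\<Sum>i<dim_row A. A $$ (i, i))"

text \<open>Meaningful for invertible arguments only: \<^const>\<open>mat_inverse\<close> returns \<^const>\<open>None\<close>
  on all other matrices.\<close>

definition minv :: "real mat \<Rightarrow> real mat" where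
  "minv A = the (mat_inverse A)"

definition mat_Sym :: "real mat \<Rightarrow> real mat" where
  "mat_Sym A = (1 / 2) \<cdot>\<^sub>m (A + A\<^sup>T)"

definition sym_mats :: "nat \<Rightarrow> real mat set" where
  "sym_mats n = {P \<in> carrier_mat n n. P\<^sup>T = P}"

definition block_diag_space :: "nat \<Rightarrow> nat \<Rightarrow> nat \<Rightarrow> real mat set" where
  "block_diag_space L M n =
    {Y \<in> carrier_mat ((L + M) * n) ((L + M) * n).
      \<exists>Ys. length Ys = L + M \<and> set Ys \<subseteq> carrier_mat n n \<and> Y = diag_block_mat Ys}"

text \<open>All indices are 0-based: \<open>E 0, \<dots>, E (n - 1)\<close> are the diagonal matrix units,
  and \<open>E n, \<dots>, E (sym_dim n - 1)\<close> enumerate the off-diagonal basis matrices in an arbitrary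
  order.\<close>

definition sym_dim :: "nat \<Rightarrow> nat" where
  "sym_dim n = n * (n + 1) div 2"

definition unit_mat :: "nat \<Rightarrow> nat \<Rightarrow> nat \<Rightarrow> real mat" where
  "unit_mat n i j = mat n n (\<lambda>(r, c). if r = i \<and> c = j then 1 else 0)"

definition canonical_sym_basis :: "nat \<Rightarrow> (nat \<Rightarrow> real mat) \<Rightarrow> bool" where
  "canonical_sym_basis n E \<longleftrightarrow>
    (\<forall>j<n. E j = unit_mat n j j) \<and>
    bij_betw E {n..<sym_dim n} {unit_mat n r c + unit_mat n c r | r c. r < c \<and> c < n}"


subsection \<open>Homogeneous matrix polynomials\<close>

definition hom_exps :: "nat \<Rightarrow> nat \<Rightarrow> nat list set" where
  "hom_exps l d = {\<gamma>. length \<gamma> = l \<and> sum_list \<gamma> = d}"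

text \<open>The 0-based position of \<open>\<gamma>\<close> in the lexicographically ordered set
  \<open>hom_exps l d\<close> to which it belongs.\<close>

definition exp_idx :: "nat list \<Rightarrow> nat" where
  "exp_idx \<gamma> = card {\<eta> \<in> hom_exps (length \<gamma>) (sum_list \<gamma>). (\<eta>, \<gamma>) \<in> lex less_than}"

definition monomial :: "real vec \<Rightarrow> nat list \<Rightarrow> real" where
  "monomial \<alpha> \<gamma> = (\<Prod>i<length \<gamma>. (\<alpha> $ i) ^ (\<gamma> ! i))"

definition hom_poly :: "nat \<Rightarrow> nat \<Rightarrow> nat \<Rightarrow> (nat \<Rightarrow> real mat) \<Rightarrow> real vec \<Rightarrow> real mat" where
  "hom_poly n l d A \<alpha> = mat_sum n (\<lambda>\<gamma>. monomial \<alpha> \<gamma> \<cdot>\<^sub>m A (exp_idx \<gamma>)) (hom_exps l d)"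

text \<open>The families \<open>\<beta>\<close> and \<open>H\<close> are given by their defining polynomial identities. Over the
  reals these are the same as identities of polynomial functions, and they determine
  \<open>\<beta>\<close> (for \<open>n > 0\<close>) and \<open>H\<close> on all relevant indices. In the identity for \<open>\<beta>\<close> the
  coefficients \<open>P\<close> are indeterminate.\<close>

definition polya_beta :: "nat \<Rightarrow> nat \<Rightarrow> nat \<Rightarrow> nat \<Rightarrow> (nat \<Rightarrow> nat \<Rightarrow> real) \<Rightarrow> bool" where
  "polya_beta n l dp d1 \<beta> \<longleftrightarrow>
    (\<forall>P. (\<forall>h \<in> hom_exps l dp. P (exp_idx h) \<in> sym_mats n) \<longrightarrow>
      (\<forall>\<alpha> \<in> carrier_vec l.
        (\<Sum>i<l. \<alpha> $ i) ^ d1 \<cdot>\<^sub>m hom_poly n l dp P \<alpha> =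
        mat_sum n (\<lambda>\<gamma>. monomial \<alpha> \<gamma> \<cdot>\<^sub>m
            mat_sum n (\<lambda>h. \<beta> (exp_idx h) (exp_idx \<gamma>) \<cdot>\<^sub>m P (exp_idx h)) (hom_exps l dp))
          (hom_exps l (dp + d1))))"

definition polya_H ::
  "nat \<Rightarrow> nat \<Rightarrow> nat \<Rightarrow> nat \<Rightarrow> nat \<Rightarrow> (nat \<Rightarrow> real mat) \<Rightarrow> (nat \<Rightarrow> nat \<Rightarrow> real mat) \<Rightarrow> bool" where
  "polya_H n l dp da d2 A H \<longleftrightarrow>
    (\<forall>h \<in> hom_exps l dp.
      (\<forall>\<gamma> \<in> hom_exps l (dp + da + d2). H (exp_idx h) (exp_idx \<gamma>) \<in> carrier_mat n n) \<and>
      (\<forall>\<alpha> \<in> carrier_vec l.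
        ((\<Sum>i<l. \<alpha> $ i) ^ d2 * monomial \<alpha> h) \<cdot>\<^sub>m hom_poly n l da A \<alpha> =
        mat_sum n (\<lambda>\<gamma>. monomial \<alpha> \<gamma> \<cdot>\<^sub>m H (exp_idx h) (exp_idx \<gamma>))
          (hom_exps l (dp + da + d2))))"


subsection \<open>Elements of the semidefinite program\<close>

definition polya_K :: "nat \<Rightarrow> nat \<Rightarrow> nat \<Rightarrow> nat" where
  "polya_K n l dp = sym_dim n * ((dp + l - 1) choose (l - 1))"

definition polya_V :: "nat \<Rightarrow> (nat \<Rightarrow> real mat) \<Rightarrow> nat list \<Rightarrow> real vec \<Rightarrow> real mat" where
  "polya_V n E h x = mat_sum n (\<lambda>j. x $ (j + sym_dim n * exp_idx h) \<cdot>\<^sub>m E j) {..<sym_dim n}"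

definition polya_C ::
  "nat \<Rightarrow> nat \<Rightarrow> nat \<Rightarrow> nat \<Rightarrow> nat \<Rightarrow> real \<Rightarrow> (nat \<Rightarrow> nat \<Rightarrow> real) \<Rightarrow> real mat" where
  "polya_C n l dp L M \<delta> \<beta> =
    diag_block_mat (map (\<lambda>i.
      if i < L then
        (\<delta> * (\<Sum>h\<in>hom_exps l dp. \<beta> (exp_idx h) i * (fact dp / (\<Prod>k<l. fact (h ! k))))) \<cdot>\<^sub>m 1\<^sub>m n
      else 0\<^sub>m n n) [0..<L + M])"

definition polya_B ::
  "nat \<Rightarrow> nat \<Rightarrow> nat \<Rightarrow> nat \<Rightarrow> nat \<Rightarrow> (nat \<Rightarrow> real mat) \<Rightarrow> (nat \<Rightarrow> nat \<Rightarrow> real) \<Rightarrow>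
    (nat \<Rightarrow> nat \<Rightarrow> real mat) \<Rightarrow> nat \<Rightarrow> real mat" where
  "polya_B n l dp L M E \<beta> H i =
    (let V = (\<lambda>h. polya_V n E h (unit_vec (polya_K n l dp) i)) in
     diag_block_mat (map (\<lambda>j.
       if j < L then mat_sum n (\<lambda>h. \<beta> (exp_idx h) j \<cdot>\<^sub>m V h) (hom_exps l dp)
       else - mat_sum n
              (\<lambda>h. (H (exp_idx h) (j - L))\<^sup>T * V h + V h * H (exp_idx h) (j - L))
              (hom_exps l dp)) [0..<L + M]))"

definition polya_a :: "nat \<Rightarrow> real vec" where
  "polya_a K = vec K (\<lambda>_. 1)"


subsection \<open>Primal-dual predictor-corrector iteration\<close>

text \<open>Here \<open>N\<close> is the size of the matrix variables and \<open>K\<close> the number of constraints.\<close>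

definition sdp_op :: "nat \<Rightarrow> (nat \<Rightarrow> real mat) \<Rightarrow> real mat \<Rightarrow> real vec" where
  "sdp_op K B X = vec K (\<lambda>i. mat_trace (B i * X))"

definition sdp_comb :: "nat \<Rightarrow> nat \<Rightarrow> (nat \<Rightarrow> real mat) \<Rightarrow> real vec \<Rightarrow> real mat" where
  "sdp_comb N K B y = mat_sum N (\<lambda>i. y $ i \<cdot>\<^sub>m B i) {..<K}"

definition pd_Omega :: "nat \<Rightarrow> (nat \<Rightarrow> real mat) \<Rightarrow> real mat \<Rightarrow> real mat \<Rightarrow> real mat" where
  "pd_Omega K B X Z = mat_of_cols K (map (\<lambda>j. sdp_op K B (minv Z * B j * X)) [0..<K])"

definition pd_step ::
  "nat \<Rightarrow> nat \<Rightarrow> (nat \<Rightarrow> real mat) \<Rightarrow> real mat \<Rightarrow> real vec \<Rightarrow> real \<Rightarrow> real \<Rightarrow> real \<Rightarrow>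
    real mat \<times> real vec \<times> real mat \<Rightarrow> real mat \<times> real vec \<times> real mat" where
  "pd_step N K B C a \<mu> tp td = (\<lambda>(X, y, Z).
    let Zi = minv Z;
        \<Omega>i = minv (pd_Omega K B X Z);
        G = - sdp_comb N K B y + Z + C;
        dy_pred = \<Omega>i *\<^sub>v (- a + sdp_op K B (Zi * G * X));
        dX_pred = - X + Zi * (G - sdp_comb N K B dy_pred) * X;
        dZ_pred = sdp_comb N K B y - Z - C + sdp_comb N K B dy_pred;
        dy_corr = \<Omega>i *\<^sub>v (sdp_op K B (\<mu> \<cdot>\<^sub>m Zi) - sdp_op K B (Zi * dZ_pred * dX_pred));
        dZ_corr = sdp_comb N K B dy_corr;
        dX_corr = \<mu> \<cdot>\<^sub>m Zi - Zi * dZ_pred * dX_pred - Zi * dZ_corr * X;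
        dX = mat_Sym (dX_pred + dX_corr);
        dy = dy_pred + dy_corr;
        dZ = dZ_pred + dZ_corr
    in (X + tp \<cdot>\<^sub>m dX, y + td \<cdot>\<^sub>v dy, Z + td \<cdot>\<^sub>m dZ))"

definition pd_iterates ::
  "nat \<Rightarrow> nat \<Rightarrow> (nat \<Rightarrow> real mat) \<Rightarrow> real mat \<Rightarrow> real vec \<Rightarrow>
    (nat \<Rightarrow> real) \<Rightarrow> (nat \<Rightarrow> real) \<Rightarrow> (nat \<Rightarrow> real) \<Rightarrow>
    (nat \<Rightarrow> real mat) \<Rightarrow> (nat \<Rightarrow> real vec) \<Rightarrow> (nat \<Rightarrow> real mat) \<Rightarrow> bool" where
  "pd_iterates N K B C a \<mu> tp td X y Z \<longleftrightarrow>
    (\<forall>k. invertible_mat (Z k) \<and> invertible_mat (pd_Omega K B (X k) (Z k)) \<and>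
      (X (Suc k), y (Suc k), Z (Suc k)) =
        pd_step N K B C a (\<mu> k) (tp k) (td k) (X k, y k, Z k))"

end

theory Submission
  imports Defs
begin

text \<open>A square matrix of size \<open>m n\<close> consists of \<open>m\<close> diagonal blocks of size \<open>n\<close> exactly when it
  commutes with \<open>D = diag(i div n)\<close>, the diagonal matrix that labels every index with the number
  of its block: the entry \<open>(i, j)\<close> of \<open>D Y - Y D\<close> is \<open>(i div n - j div n) Y\<^sub>i\<^sub>j\<close>, so commuting with
  \<open>D\<close> means that \<open>Y\<close> vanishes outside the blocks (\<open>block_diag_space_iff_commute\<close>). The
  block-diagonal matrices are therefore the commutant of \<open>D\<close>, and as such an algebra that contains
  the inverses of its invertible elements. Transposition preserves it too, since the condition
  \<open>i div n \<noteq> j div n\<close> is symmetric in \<open>i\<close> and \<open>j\<close>.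

  The data \<open>C\<close> and \<open>B\<^sub>i\<close> of the semidefinite program lie in this algebra by construction. Each
  step forms the new \<open>X\<close> and \<open>Z\<close> from the old ones, from \<open>C\<close> and from linear combinations of the
  \<open>B\<^sub>i\<close> by sums, products, scalar multiples, \<open>Z\<^sup>-\<^sup>1\<close> and symmetrization
  (\<open>pd_step_block_diag\<close>). The matrix \<open>\<Omega>\<close>, the vector \<open>y\<close> and the step sizes enter only
  through scalar coefficients, whose values do not affect membership in a linear space. The claim
  follows by induction on the number of steps.\<close>

section \<open>Block-diagonal matrices by entries and as a commutant\<close>

lemma diag_block_mat_square_carrier:
  assumes "set Ys \<subseteq> carrier_mat n n"
  shows "diag_block_mat Ys \<in> carrier_mat (length Ys * n) (length Ys * n)"
  using assms
proof (induction Ys)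
  case (Cons Y Ys)
  then have "Y \<in> carrier_mat n n"
    and "diag_block_mat Ys \<in> carrier_mat (length Ys * n) (length Ys * n)" by auto
  then show ?case by (auto simp: Let_def)
qed auto

lemma diag_block_mat_index:
  fixes Ys :: "'a :: zero mat list"
  assumes "set Ys \<subseteq> carrier_mat n n" and "i < length Ys * n" and "j < length Ys * n"
  shows "diag_block_mat Ys $$ (i, j) =
    (if i div n = j div n then (Ys ! (i div n)) $$ (i mod n, j mod n) else 0)"
  using assms
proof (induction Ys arbitrary: i j)
  case (Cons Y Ys)
  have n: "0 < n" using Cons.prems(2) by (cases n) auto
  have Y: "Y \<in> carrier_mat n n" using Cons.prems(1) by auto
  have D: "diag_block_mat Ys \<in> carrier_mat (length Ys * n) (length Ys * n)"
    using Cons.prems(1) by (intro diag_block_mat_square_carrier) auto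
  have IH: "diag_block_mat Ys $$ (i', j') =
      (if i' div n = j' div n then (Ys ! (i' div n)) $$ (i' mod n, j' mod n) else 0)"
    if "i' < length Ys * n" "j' < length Ys * n" for i' j'
    using Cons.IH[OF _ that] Cons.prems(1) by auto
  have low: "k div n = 0" "k mod n = k" if "k < n" for k using that by auto
  have high: "k div n = Suc ((k - n) div n)" "k mod n = (k - n) mod n" if "\<not> k < n" for k
    using that n by (auto simp: le_div_geq le_mod_geq)
  have eq: "diag_block_mat (Y # Ys) $$ (i, j) =
     (if i < n then if j < n then Y $$ (i, j) else 0
      else if j < n then 0 else diag_block_mat Ys $$ (i - n, j - n))"
    using Y D Cons.prems(2,3) by (auto simp: Let_def)
  show ?case
    unfolding eq using Cons.prems(2,3) low[of i] low[of j] high[of i] high[of j]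
      IH[of "i - n" "j - n"] by (cases "i < n"; cases "j < n") auto
qed auto

lemma block_diag_space_iff_index:
  "Y \<in> block_diag_space L M n \<longleftrightarrow>
    Y \<in> carrier_mat ((L + M) * n) ((L + M) * n) \<and>
    (\<forall>i<(L + M) * n. \<forall>j<(L + M) * n. i div n \<noteq> j div n \<longrightarrow> Y $$ (i, j) = 0)"
  (is "_ \<longleftrightarrow> ?R")
proof
  assume "Y \<in> block_diag_space L M n"
  then show ?R by (auto simp: block_diag_space_def diag_block_mat_index)
next
  assume R: ?R
  define Ys where "Ys = map (\<lambda>b. mat n n (\<lambda>(r, c). Y $$ (b * n + r, b * n + c))) [0..<L + M]"
  have Ys: "length Ys = L + M" "set Ys \<subseteq> carrier_mat n n" by (auto simp: Ys_def)
  have "Y = diag_block_mat Ys"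
  proof (rule eq_matI)
    fix i j assume "i < dim_row (diag_block_mat Ys)" "j < dim_col (diag_block_mat Ys)"
    then have ij: "i < (L + M) * n" "j < (L + M) * n"
      using diag_block_mat_square_carrier[OF Ys(2)] Ys(1) by auto
    then have "0 < n" by (cases n) auto
    moreover have "i div n < L + M" using ij(1) by (simp add: less_mult_imp_div_less)
    ultimately have "i div n = j div n \<Longrightarrow> (Ys ! (i div n)) $$ (i mod n, j mod n) = Y $$ (i, j)"
      unfolding Ys_def by simp (metis div_mult_mod_eq)
    then show "Y $$ (i, j) = diag_block_mat Ys $$ (i, j)"
      using diag_block_mat_index[OF Ys(2)] ij R Ys(1) by auto
  qed (use R diag_block_mat_square_carrier[OF Ys(2)] Ys(1) in auto)
  then show "Y \<in> block_diag_space L M n"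
    using R Ys unfolding block_diag_space_def by blast
qed

definition block_label_mat :: "nat \<Rightarrow> nat \<Rightarrow> real mat" where
  "block_label_mat N n = mat_diag N (\<lambda>i. real (i div n))"

lemma block_label_mat_carrier [simp]: "block_label_mat N n \<in> carrier_mat N N"
  by (simp add: block_label_mat_def)

text \<open>Entry \<open>(i, j)\<close> of the commutator is \<open>Y\<^sub>i\<^sub>j\<close> times the difference of the labels of \<open>i\<close> and
  \<open>j\<close>. Distinct blocks have distinct labels, so the commutator is zero only if all entries outside
  the blocks are.\<close>

lemma block_diag_space_iff_commute:
  fixes L M n :: nat
  defines "N \<equiv> (L + M) * n"
  shows "Y \<in> block_diag_space L M n \<longleftrightarrow>
    Y \<in> carrier_mat N N \<and> block_label_mat N n * Y = Y * block_label_mat N n"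
proof (cases "Y \<in> carrier_mat N N")
  case True
  have "block_label_mat N n * Y = mat N N (\<lambda>(i, j). real (i div n) * Y $$ (i, j))"
    and "Y * block_label_mat N n = mat N N (\<lambda>(i, j). Y $$ (i, j) * real (j div n))"
    using True by (simp_all add: block_label_mat_def mat_diag_mult_left mat_diag_mult_right)
  then have "block_label_mat N n * Y = Y * block_label_mat N n \<longleftrightarrow>
      (\<forall>i<N. \<forall>j<N. real (i div n) * Y $$ (i, j) = Y $$ (i, j) * real (j div n))"
    by simp (auto simp: mat_eq_iff)
  also have "\<dots> \<longleftrightarrow> (\<forall>i<N. \<forall>j<N. i div n \<noteq> j div n \<longrightarrow> Y $$ (i, j) = 0)"
    by (auto simp: mult.commute)
  finally show ?thesis
    using True unfolding block_diag_space_iff_index N_def[symmetric] by blast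
qed (auto simp: block_diag_space_iff_index N_def)


section \<open>The algebra of block-diagonal matrices\<close>

named_theorems block_diag_closed

lemma block_diag_space_add [block_diag_closed]:
  assumes "X \<in> block_diag_space L M n" and "Y \<in> block_diag_space L M n"
  shows "X + Y \<in> block_diag_space L M n"
  using assms by (auto simp: block_diag_space_iff_index)

lemma block_diag_space_uminus [block_diag_closed]:
  assumes "X \<in> block_diag_space L M n"
  shows "- X \<in> block_diag_space L M n"
  using assms by (auto simp: block_diag_space_iff_index)

lemma block_diag_space_minus [block_diag_closed]:
  assumes "X \<in> block_diag_space L M n" and "Y \<in> block_diag_space L M n"
  shows "X - Y \<in> block_diag_space L M n"
  using assms by (auto simp: block_diag_space_iff_index)

lemma block_diag_space_smult [block_diag_closed]:
  assumes "X \<in> block_diag_space L M n"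
  shows "s \<cdot>\<^sub>m X \<in> block_diag_space L M n"
  using assms by (auto simp: block_diag_space_iff_index)

lemma block_diag_space_mat_sum:
  assumes "\<And>i. i \<in> I \<Longrightarrow> F i \<in> block_diag_space L M n"
  shows "mat_sum ((L + M) * n) F I \<in> block_diag_space L M n"
  using assms by (auto simp: block_diag_space_iff_index mat_sum_def)

lemma block_diag_space_mult [block_diag_closed]:
  assumes "X \<in> block_diag_space L M n" and "Y \<in> block_diag_space L M n"
  shows "X * Y \<in> block_diag_space L M n"
proof -
  define N where "N = (L + M) * n"
  let ?D = "block_label_mat N n"
  have X: "X \<in> carrier_mat N N" "?D * X = X * ?D" and Y: "Y \<in> carrier_mat N N" "?D * Y = Y * ?D"
    using assms by (auto simp: block_diag_space_iff_commute N_def)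
  have D: "?D \<in> carrier_mat N N" by simp
  have "?D * (X * Y) = X * ?D * Y"
    using assoc_mult_mat[OF D X(1) Y(1)] X(2) by simp
  also have "\<dots> = X * Y * ?D"
    using assoc_mult_mat[OF X(1) D Y(1)] assoc_mult_mat[OF X(1) Y(1) D] Y(2) by simp
  finally show ?thesis
    using X(1) Y(1) by (auto simp: block_diag_space_iff_commute N_def)
qed

lemma block_diag_space_transpose [block_diag_closed]:
  assumes "X \<in> block_diag_space L M n"
  shows "X\<^sup>T \<in> block_diag_space L M n"
  using assms by (auto simp: block_diag_space_iff_index)

lemma block_diag_space_mat_Sym [block_diag_closed]:
  assumes "X \<in> block_diag_space L M n"
  shows "mat_Sym X \<in> block_diag_space L M n"
  unfolding mat_Sym_def by (intro block_diag_closed assms)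

lemma minv_inverse:
  assumes "A \<in> carrier_mat N N" and "invertible_mat A"
  shows "minv A \<in> carrier_mat N N" and "A * minv A = 1\<^sub>m N" and "minv A * A = 1\<^sub>m N"
proof -
  obtain B where B: "A * B = 1\<^sub>m N" "B * A = 1\<^sub>m (dim_row B)"
    using assms by (auto simp: invertible_mat_def inverts_mat_def)
  have "dim_col B = N" using arg_cong[OF B(1), of dim_col] by simp
  moreover have "dim_row B = N" using arg_cong[OF B(2), of dim_col] assms(1) by simp
  ultimately have "B \<in> carrier_mat N N" by auto
  then have "A \<in> Units (ring_mat TYPE(real) N ())"
    using B assms(1) by (auto simp: Units_def ring_mat_def)
  then obtain A' where "mat_inverse A = Some A'"
    using mat_inverse(1)[OF assms(1), where b = "()"] by (cases "mat_inverse A") auto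
  with mat_inverse(2)[OF assms(1) this]
  show "minv A \<in> carrier_mat N N" "A * minv A = 1\<^sub>m N" "minv A * A = 1\<^sub>m N"
    by (auto simp: minv_def)
qed

text \<open>The commutant of any matrix \<open>D\<close> is closed under inverses: multiplying \<open>D Z = Z D\<close> by
  \<open>Z\<^sup>-\<^sup>1\<close> on both sides gives \<open>Z\<^sup>-\<^sup>1 D = D Z\<^sup>-\<^sup>1\<close>. This is why the commutant description is
  used: no formula for the blocks of the inverse is needed.\<close>

lemma block_diag_space_minv:
  assumes "Z \<in> block_diag_space L M n" and "invertible_mat Z"
  shows "minv Z \<in> block_diag_space L M n"
proof -
  define N where "N = (L + M) * n"
  define W where "W = minv Z"
  let ?D = "block_label_mat N n"
  have Z: "Z \<in> carrier_mat N N" "?D * Z = Z * ?D"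
    using assms by (auto simp: block_diag_space_iff_commute N_def)
  have W: "W \<in> carrier_mat N N" "Z * W = 1\<^sub>m N" "W * Z = 1\<^sub>m N"
    using minv_inverse[OF Z(1) assms(2)] by (auto simp: W_def)
  have D: "?D \<in> carrier_mat N N" by simp
  have "?D * W = (W * Z) * (?D * W)"
    using W(3) left_mult_one_mat[OF mult_carrier_mat[OF D W(1)]] by simp
  also have "\<dots> = W * (Z * ?D * W)"
    using assoc_mult_mat[OF W(1) Z(1), of "?D * W" N] assoc_mult_mat[OF Z(1) D W(1)] W(1) D by simp
  also have "\<dots> = W * (?D * (Z * W))"
    using assoc_mult_mat[OF D Z(1) W(1)] Z(2) by simp
  also have "\<dots> = W * ?D"
    using W(2) right_mult_one_mat[OF D] by simp
  finally show ?thesis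
    using W(1) unfolding block_diag_space_iff_commute N_def W_def by blast
qed


section \<open>The data and the step of the iteration\<close>

lemma mat_sum_carrier [simp]: "mat_sum n F I \<in> carrier_mat n n"
  by (simp add: mat_sum_def)

lemma diag_block_mat_in_block_diag_space:
  assumes "length Ys = L + M" and "set Ys \<subseteq> carrier_mat n n"
  shows "diag_block_mat Ys \<in> block_diag_space L M n"
  using assms diag_block_mat_square_carrier[OF assms(2)] by (auto simp: block_diag_space_def)

lemma polya_C_block_diag: "polya_C n l dp L M \<delta> \<beta> \<in> block_diag_space L M n"
  unfolding polya_C_def by (rule diag_block_mat_in_block_diag_space) auto

lemma polya_B_block_diag: "polya_B n l dp L M E \<beta> H i \<in> block_diag_space L M n"
  unfolding polya_B_def Let_def by (rule diag_block_mat_in_block_diag_space) auto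

lemma sdp_comb_block_diag:
  assumes "\<And>i. i < K \<Longrightarrow> B i \<in> block_diag_space L M n"
  shows "sdp_comb ((L + M) * n) K B v \<in> block_diag_space L M n"
  unfolding sdp_comb_def
  by (intro block_diag_space_mat_sum block_diag_space_smult assms) simp

lemma pd_step_block_diag:
  assumes B: "\<And>i. i < K \<Longrightarrow> B i \<in> block_diag_space L M n"
    and C: "C \<in> block_diag_space L M n"
    and X: "X \<in> block_diag_space L M n"
    and Z: "Z \<in> block_diag_space L M n" and inv: "invertible_mat Z"
    and step: "(X', y', Z') = pd_step ((L + M) * n) K B C a \<mu> tp td (X, y, Z)"
  shows "X' \<in> block_diag_space L M n" and "Z' \<in> block_diag_space L M n"
proof -
  note closed = block_diag_closed C X Z block_diag_space_minv[OF Z inv] sdp_comb_block_diag[OF B]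
  show "X' \<in> block_diag_space L M n"
    using step unfolding pd_step_def Let_def split_conv prod.inject by (auto intro!: closed)
  show "Z' \<in> block_diag_space L M n"
    using step unfolding pd_step_def Let_def split_conv prod.inject by (auto intro!: closed)
qed


section \<open>Block-diagonality of all iterates\<close>

theorem theorem15:
  fixes l n dp da d1 d2 L M K :: nat
    and \<delta> :: real
    and A E :: "nat \<Rightarrow> real mat"
    and \<beta> :: "nat \<Rightarrow> nat \<Rightarrow> real"
    and H :: "nat \<Rightarrow> nat \<Rightarrow> real mat"
    and X Z :: "nat \<Rightarrow> real mat"
    and y :: "nat \<Rightarrow> real vec"
    and \<mu> tp td :: "nat \<Rightarrow> real"
  assumes "0 < l" and "0 < n" and "0 < \<delta>"
    and "\<forall>\<gamma> \<in> hom_exps l da. A (exp_idx \<gamma>) \<in> carrier_mat n n"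
    and "canonical_sym_basis n E"
    and "polya_beta n l dp d1 \<beta>"
    and "polya_H n l dp da d2 A H"
    and "L = card (hom_exps l (dp + d1))"
    and "M = card (hom_exps l (dp + da + d2))"
    and "K = polya_K n l dp"
    and "pd_iterates ((L + M) * n) K (polya_B n l dp L M E \<beta> H) (polya_C n l dp L M \<delta> \<beta>)
           (polya_a K) \<mu> tp td X y Z"
    and "X 0 \<in> block_diag_space L M n"
    and "y 0 \<in> carrier_vec K"
    and "Z 0 \<in> block_diag_space L M n"
  shows "\<forall>k. X k \<in> block_diag_space L M n \<and> Z k \<in> block_diag_space L M n"
proof
  fix k
  show "X k \<in> block_diag_space L M n \<and> Z k \<in> block_diag_space L M n"
  proof (induction k)
    case 0
    show ?case using assms(12,14) by simp
  next
    case (Suc k)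
    have "invertible_mat (Z k)"
      and "(X (Suc k), y (Suc k), Z (Suc k)) =
        pd_step ((L + M) * n) K (polya_B n l dp L M E \<beta> H) (polya_C n l dp L M \<delta> \<beta>)
          (polya_a K) (\<mu> k) (tp k) (td k) (X k, y k, Z k)"
      using assms(11) by (auto simp: pd_iterates_def)
    with Suc.IH show ?case
      by (metis pd_step_block_diag polya_B_block_diag polya_C_block_diag)
  qed
qed

end
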